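(* Let $G$ be a locally compact Abelian group with Haar measure $\mu$, and let $A\subset G$ be a Borel measurable set with $\overline{\Delta}(A)>0$. Then there exists a finite subset $B\subset G$ such that $A-A+B=G$. Moreover, $B$ can be chosen with $\#B\le [1/\overline{\Delta}(A)]$.
   Context: $G$ is a locally compact (Hausdorff) Abelian group written additively, with a fixed Haar measure $\mu$. $\mathcal{B}_0$ denotes the family of all nonempty open subsets of $G$ with compact closure. For a Borel set $A\subset G$, $$\overline{\Delta}(A):=\inf_{F}\ \sup_{V\in\mathcal{B}_0}\frac{\mu(A\cap V)}{\mu(F+V)},$$ where the infimum is over all nonempty finite $F\subset G$. Sums and differences of sets are Minkowski (elementwise): $A-A+B=\{a-a'+b: a,a'\in A,\ b\in B\}$. $[x]$ is the integer part of $x$ and $\#$ denotes cardinality. *)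

theory Defs
  imports "HOL-Analysis.Analysis" "HOL-Library.Set_Algebras"
begin

text \<open>
  A Haar measure is a nonzero translation-invariant Radon measure on the Borel sets: finite on
  compact sets, outer regular on Borel sets and inner regular on open sets. (Inner regularity
  on all Borel sets would be too much to ask, as the group need not be \<open>\<sigma>\<close>-compact.)
\<close>

definition haar_measure :: "'a::{topological_ab_group_add, t2_space} measure \<Rightarrow> bool" where
  "haar_measure M \<longleftrightarrow>
     sets M = sets borel \<and>
     emeasure M UNIV \<noteq> 0 \<and>
     (\<forall>x. \<forall>E\<in>sets borel. emeasure M ((\<lambda>y. x + y) ` E) = emeasure M E) \<and>
     (\<forall>K. compact K \<longrightarrow> emeasure M K < \<infinity>) \<and>
     (\<forall>E\<in>sets borel. emeasure M E = (INF U\<in>{U. open U \<and> E \<subseteq> U}. emeasure M U)) \<and>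
     (\<forall>U. open U \<longrightarrow> emeasure M U = (SUP K\<in>{K. compact K \<and> K \<subseteq> U}. emeasure M K))"

definition relcompact_opens :: "'a::topological_space set set" where
  "relcompact_opens = {V. open V \<and> V \<noteq> {} \<and> compact (closure V)}"

text \<open>
  For a Haar measure on a locally compact group and a Borel set \<open>A\<close>, every quantity below is a
  genuine real number: \<open>F + V\<close> (the elementwise sum) is a nonempty open set with compact
  closure, so it has finite positive measure, and each ratio lies between 0 and 1. Hence the
  real-valued supremum and infimum range over nonempty bounded sets.
\<close>

definition upper_density ::
    "'a::{topological_ab_group_add, t2_space} measure \<Rightarrow> 'a set \<Rightarrow> real" where
  "upper_density M A =
     (INF F\<in>{F. finite F \<and> F \<noteq> {}}.
        SUP V\<in>relcompact_opens. measure M (A \<inter> V) / measure M (F + V))"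

text \<open>Elementwise difference; the library's \<open>-\<close> on sets is set difference.\<close>

definition set_minus_elementwise :: "'a::minus set \<Rightarrow> 'a set \<Rightarrow> 'a set" where
  "set_minus_elementwise A B = {a - b | a b. a \<in> A \<and> b \<in> B}"

end

theory Submission
  imports Defs
begin

text \<open>
  If the translates \<open>b + A\<close>, \<open>b \<in> B\<close>, are pairwise disjoint, then for every \<open>V\<close> the sets
  \<open>b + (A \<inter> V)\<close> pack into \<open>B + V\<close>, so the choice \<open>F = B\<close> in the definition shows that the upper
  density is at most \<open>1 / card B\<close>. Positive density thus bounds the size of such packings, and
  a packing \<open>B\<close> of maximal cardinality satisfies \<open>A - A + B = G\<close>: every further translate of
  \<open>A\<close> meets some \<open>b + A\<close>.
\<close>

text \<open>Preimages under the continuous map \<open>\<lambda>y. - x + y\<close> preserve openness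
  and Borel measurability, so translates inherit both through this identity.\<close>

lemma translation_image_eq_vimage:
  fixes x :: "'a::group_add"
  shows "(\<lambda>y. x + y) ` E = (\<lambda>y. - x + y) -` E"
proof
  show "(\<lambda>y. - x + y) -` E \<subseteq> (\<lambda>y. x + y) ` E"
  proof
    fix z assume "z \<in> (\<lambda>y. - x + y) -` E"
    then show "z \<in> (\<lambda>y. x + y) ` E"
      by (intro image_eqI[where x = "- x + z"]) (simp_all add: add.assoc[symmetric])
  qed
qed (auto simp: add.assoc[symmetric])

lemma borel_translation_image:
  fixes x :: "'a::topological_ab_group_add"
  assumes "E \<in> sets borel"
  shows "(\<lambda>y. x + y) ` E \<in> sets borel"
proof -
  have "(\<lambda>y. - x + y) \<in> borel_measurable borel"
    by (intro borel_measurable_continuous_onI continuous_intros)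
  from measurable_sets[OF this assms] show ?thesis
    by (simp add: translation_image_eq_vimage)
qed

lemma open_translation_image:
  fixes x :: "'a::topological_ab_group_add"
  assumes "open V"
  shows "open ((\<lambda>y. x + y) ` V)"
  unfolding translation_image_eq_vimage
  using assms by (intro open_vimage continuous_intros)

lemma set_plus_eq_UN_translations: "F + V = (\<Union>x\<in>F. (\<lambda>y. x + y) ` V)"
  by (auto simp: set_plus_def)

lemma haar_measure_sets: "haar_measure M \<Longrightarrow> sets M = sets borel"
  by (simp add: haar_measure_def)

lemma haar_measure_translation:
  "haar_measure M \<Longrightarrow> E \<in> sets borel \<Longrightarrow> emeasure M ((\<lambda>y. x + y) ` E) = emeasure M E"
  by (simp add: haar_measure_def)

lemma haar_measure_relcompact_finite:
  assumes M: "haar_measure M" and V: "V \<in> relcompact_opens"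
  shows "emeasure M V < \<infinity>"
proof -
  have "emeasure M V \<le> emeasure M (closure V)"
    by (intro emeasure_mono closure_subset) (simp add: haar_measure_sets[OF M])
  also have "\<dots> < \<infinity>"
    using M V unfolding haar_measure_def relcompact_opens_def by blast
  finally show ?thesis .
qed

text \<open>\<open>F + V\<close> is a union of finitely many translates of the open set
  \<open>V\<close>; it is therefore open, and by subadditivity and invariance its measure is at most
  \<open>card F\<close> times that of \<open>V\<close>.\<close>

lemma haar_measure_finite_plus_relcompact:
  assumes M: "haar_measure M" and V: "V \<in> relcompact_opens" and "finite F"
  shows "F + V \<in> sets borel" "emeasure M (F + V) < \<infinity>"
proof -
  have oV: "open V" using V by (simp add: relcompact_opens_def)
  then show "F + V \<in> sets borel"
    unfolding set_plus_eq_UN_translations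
    by (intro borel_open open_UN ballI open_translation_image)
  have "emeasure M (F + V) \<le> (\<Sum>x\<in>F. emeasure M ((\<lambda>y. x + y) ` V))"
    unfolding set_plus_eq_UN_translations using \<open>finite F\<close> oV
    by (intro emeasure_subadditive_finite)
      (auto simp: haar_measure_sets[OF M] intro: borel_translation_image)
  also have "\<dots> < \<infinity>"
    using haar_measure_relcompact_finite[OF M V] oV
    by (simp add: haar_measure_translation[OF M] ennreal_mult_less_top of_nat_less_top)
  finally show "emeasure M (F + V) < \<infinity>" .
qed

text \<open>\<open>F\<close> is kept apart from the packing \<open>B\<close> for two uses:
  \<open>B = F\<close> yields the density bound, while a singleton \<open>B\<close> inside an
  arbitrary \<open>F\<close> bounds every ratio by 1.\<close>

lemma haar_measure_packing_le:
  assumes M: "haar_measure M" and A: "A \<in> sets borel" and V: "V \<in> relcompact_opens"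
    and F: "finite F" and B: "B \<subseteq> F"
    and disj: "disjoint_family_on (\<lambda>x. (\<lambda>y. x + y) ` A) B"
  shows "real (card B) * measure M (A \<inter> V) \<le> measure M (F + V)"
proof -
  have finB: "finite B" using F B by (rule rev_finite_subset)
  have AV: "A \<inter> V \<in> sets borel"
    using A V by (auto simp: relcompact_opens_def)
  \<comment> \<open>The real-valued \<open>measure\<close> is 0 on sets of infinite measure, so its
    additivity over the translates requires finiteness.\<close>
  have "emeasure M (A \<inter> V) \<le> emeasure M V"
    using V by (intro emeasure_mono) (auto simp: haar_measure_sets[OF M] relcompact_opens_def)
  also note haar_measure_relcompact_finite[OF M V]
  finally have fin: "emeasure M (A \<inter> V) < \<infinity>" .
  have eq: "measure M ((\<lambda>y. x + y) ` (A \<inter> V)) = measure M (A \<inter> V)" for x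
    by (simp add: measure_def haar_measure_translation[OF M AV])
  have "measure M (\<Union>x\<in>B. (\<lambda>y. x + y) ` (A \<inter> V))
      = (\<Sum>x\<in>B. measure M ((\<lambda>y. x + y) ` (A \<inter> V)))"
  proof (rule measure_finite_Union[OF finB])
    show "(\<lambda>x. (\<lambda>y. x + y) ` (A \<inter> V)) ` B \<subseteq> sets M"
      by (auto simp: haar_measure_sets[OF M] intro: borel_translation_image[OF AV])
    show "disjoint_family_on (\<lambda>x. (\<lambda>y. x + y) ` (A \<inter> V)) B"
      using disj unfolding disjoint_family_on_def by blast
    show "emeasure M ((\<lambda>y. x + y) ` (A \<inter> V)) \<noteq> \<infinity>" for x
      using fin by (simp add: haar_measure_translation[OF M AV])
  qed
  then have "real (card B) * measure M (A \<inter> V) = measure M (\<Union>x\<in>B. (\<lambda>y. x + y) ` (A \<inter> V))"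
    by (simp add: eq)
  also have "\<dots> \<le> measure M (F + V)"
  proof (rule measure_mono_fmeasurable)
    show "(\<Union>x\<in>B. (\<lambda>y. x + y) ` (A \<inter> V)) \<subseteq> F + V"
      unfolding set_plus_eq_UN_translations using B by blast
    show "(\<Union>x\<in>B. (\<lambda>y. x + y) ` (A \<inter> V)) \<in> sets M"
      using finB by (auto simp: haar_measure_sets[OF M] intro!: borel_translation_image[OF AV])
    \<comment> \<open>Finiteness matters here too: an infinite \<open>emeasure\<close> would make
      the right-hand \<open>measure\<close> collapse to 0.\<close>
    show "F + V \<in> fmeasurable M"
      using haar_measure_finite_plus_relcompact[OF M V F]
      by (intro fmeasurableI) (simp_all add: haar_measure_sets[OF M])
  qed
  finally show ?thesis .
qed

lemma haar_measure_packing_ratio_le: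
  assumes "haar_measure M" "A \<in> sets borel" "V \<in> relcompact_opens"
    and "finite F" "B \<subseteq> F" "B \<noteq> {}"
    and "disjoint_family_on (\<lambda>x. (\<lambda>y. x + y) ` A) B"
  shows "measure M (A \<inter> V) / measure M (F + V) \<le> 1 / real (card B)"
proof -
  have "card B > 0"
    using assms by (meson card_gt_0_iff rev_finite_subset)
  moreover have "real (card B) * measure M (A \<inter> V) \<le> measure M (F + V)"
    using assms by (intro haar_measure_packing_le)
  ultimately show ?thesis
    \<comment> \<open>With a zero denominator the quotient is 0 by convention; otherwise both
      denominators are cleared.\<close>
    by (cases "measure M (F + V) = 0")
      (simp_all add: field_simps zero_less_measure_iff)
qed

text \<open>Suprema of reals over \<open>relcompact_opens\<close> are meaningful only if the family
  is nonempty. A neighbourhood \<open>U\<close> of any point, here \<open>undefined\<close>, inside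
  a compact \<open>K\<close> serves: \<open>K\<close> is closed by the Hausdorff property, so
  \<open>closure U\<close> is a closed subset of it.\<close>

lemma relcompact_opens_nonempty:
  assumes "locally_compact_space (euclidean :: 'a::t2_space topology)"
  shows "(relcompact_opens :: 'a set set) \<noteq> {}"
proof -
  obtain U K :: "'a set" where "open U" "compact K" "undefined \<in> U" "U \<subseteq> K"
    using assms unfolding locally_compact_space_def by simp blast
  moreover from this have "closure U \<subseteq> K"
    by (intro closure_minimal compact_imp_closed)
  ultimately have "U \<in> relcompact_opens"
    using compact_Int_closed[of K "closure U"]
    by (auto simp: relcompact_opens_def Int_absorb1)
  then show ?thesis by blast
qed

lemma upper_density_packing_le:
  fixes M :: "'a::{topological_ab_group_add, t2_space} measure"
  assumes lc: "locally_compact_space (euclidean :: 'a topology)"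
    and M: "haar_measure M" and A: "A \<in> sets borel"
    and B: "finite B" "B \<noteq> {}"
    and disj: "disjoint_family_on (\<lambda>x. (\<lambda>y. x + y) ` A) B"
  shows "upper_density M A \<le> 1 / real (card B)"
proof -
  let ?r = "\<lambda>F V. measure M (A \<inter> V) / measure M (F + V)"
  note ne = relcompact_opens_nonempty[OF lc]
  \<comment> \<open>A single translate is trivially a packing, so the ratio bound applies to
    \<open>{x}\<close> with cardinality 1.\<close>
  have ratio_le_1: "?r F V \<le> 1"
    if F: "finite F" "x \<in> F" and V: "V \<in> relcompact_opens" for F V x
    using haar_measure_packing_ratio_le[OF M A V F(1), of "{x}"] F(2)
    by (simp add: disjoint_family_on_def)
  \<comment> \<open>Bounding the real infimum by its value at \<open>F = B\<close> needs a lower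
    bound for all the suprema. Each one dominates some nonnegative ratio, since the ratios are
    bounded above by 1.\<close>
  have SUP_nonneg: "0 \<le> (SUP V\<in>relcompact_opens. ?r F V)" if F: "finite F" "F \<noteq> {}" for F
  proof -
    obtain V where V: "V \<in> (relcompact_opens :: 'a set set)" using ne by blast
    have "bdd_above (?r F ` relcompact_opens)"
      using F ratio_le_1 by (intro bdd_aboveI[where M = 1]) blast
    then show ?thesis
      using V by (intro cSUP_upper2[where x = V]) auto
  qed
  have "upper_density M A \<le> (SUP V\<in>relcompact_opens. ?r B V)"
    unfolding upper_density_def
    using B SUP_nonneg by (intro cINF_lower bdd_belowI[where m = 0]) auto
  also have "\<dots> \<le> 1 / real (card B)"
    using B disj ne by (intro cSUP_least haar_measure_packing_ratio_le[OF M A]) auto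
  finally show ?thesis .
qed

text \<open>Serves to extract a point of \<open>A\<close> from positive density. All ratios vanish,
  and both index families are nonempty.\<close>

lemma upper_density_empty:
  assumes "locally_compact_space (euclidean :: 'a::{topological_ab_group_add, t2_space} topology)"
  shows "upper_density M ({} :: 'a set) = 0"
proof -
  have "{F :: 'a set. finite F \<and> F \<noteq> {}} \<noteq> {}" by blast
  then show ?thesis
    using relcompact_opens_nonempty[OF assms] by (simp add: upper_density_def)
qed

theorem theorem4:
  fixes M :: "'a::{topological_ab_group_add, t2_space} measure"
    and A :: "'a set"
  assumes "locally_compact_space (euclidean :: 'a topology)"
    and "haar_measure M"
    and "A \<in> sets borel"
    and "upper_density M A > 0"
  shows "\<exists>B :: 'a set. finite B \<and> set_minus_elementwise A A + B = UNIV
           \<and> int (card B) \<le> \<lfloor>1 / upper_density M A\<rfloor>"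
proof -
  define packing :: "'a set \<Rightarrow> bool"
    where "packing B \<longleftrightarrow> finite B \<and> disjoint_family_on (\<lambda>x. (\<lambda>y. x + y) ` A) B" for B
  have card_le: "int (card B) \<le> \<lfloor>1 / upper_density M A\<rfloor>" if "packing B" for B
  proof (cases "B = {}")
    case False
    then have "upper_density M A \<le> 1 / real (card B)"
      using that assms by (intro upper_density_packing_le) (auto simp: packing_def)
    moreover have "card B > 0"
      using that False by (auto simp: packing_def card_gt_0_iff)
    ultimately show ?thesis
      using assms(4) by (simp add: le_floor_iff field_simps)
  qed (use assms(4) in simp)
  have "packing {}" by (simp add: packing_def disjoint_family_on_def)
  moreover have "\<forall>B. packing B \<longrightarrow> card B \<le> nat \<lfloor>1 / upper_density M A\<rfloor>"
    using card_le nat_mono by fastforce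
  \<comment> \<open>Packings exist, since \<open>{}\<close> is one, and their cardinalities lie
    strictly below the \<open>Suc\<close> bound, so a largest one exists.\<close>
  ultimately obtain B where B: "packing B" and max: "\<And>C. packing C \<Longrightarrow> card C \<le> card B"
    using ex_has_greatest_nat[of packing "{}" card "Suc (nat \<lfloor>1 / upper_density M A\<rfloor>)"]
    by (auto simp: less_Suc_eq_le)
  obtain a where a: "a \<in> A"
    using assms(1,4) upper_density_empty[of M] by fastforce
  have "x \<in> set_minus_elementwise A A + B" for x
  proof -
    have "\<exists>b\<in>B. \<exists>u\<in>A. \<exists>v\<in>A. x = (u - v) + b"
    proof (cases "x \<in> B")
      case True
      \<comment> \<open>Here \<open>x = (a - a) + x\<close> with \<open>b = x\<close>.\<close>
      then show ?thesis using a by force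
    next
      case False
      then have "card (insert x B) > card B"
        using B by (simp add: packing_def)
      then have "\<not> packing (insert x B)" using max by fastforce
      then obtain b where "b \<in> B" "(\<lambda>y. x + y) ` A \<inter> (\<lambda>y. b + y) ` A \<noteq> {}"
        using B False by (auto simp: packing_def disjoint_family_on_insert)
      \<comment> \<open>A common point of the two translates, written in both ways and then solved
        for \<open>x\<close>.\<close>
      then obtain u v where "u \<in> A" "v \<in> A" "x + v = b + u" by blast
      then have "x = (u - v) + b" by (metis add.commute add_diff_eq eq_diff_eq)
      then show ?thesis using \<open>b \<in> B\<close> \<open>u \<in> A\<close> \<open>v \<in> A\<close> by blast
    qed
    then show ?thesis
      unfolding set_minus_elementwise_def set_plus_def by blast
  qed
  then have "set_minus_elementwise A A + B = UNIV" by blast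
  then show ?thesis
    using B card_le by (auto simp: packing_def)
qed

end
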